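(* For every integer $n > 9$ with $n \equiv 1 \pmod 4$, $DD_{\mathrm{m}}(P_3 \,\square\, P_n)=\gamma(P_3 \,\square\, P_n)+1$.
   Context: $P_k$ is the path on $k$ vertices and $\gamma(G)$ is the domination number of $G$. $G\,\square\,H$ denotes the Cartesian product: vertex set $V(G)\times V(H)$, with $(a,b)$ and $(c,d)$ adjacent iff $a=c$ and $bd\in E(H)$, or $ac\in E(G)$ and $b=d$. Swap number: a dominating set $D$ of a graph $G$ is a swap set if there is a dominating set $D'$ of $G$ with $D\cap D'=\emptyset$, $|D|=|D'|$, such that $G$ contains a perfect matching between $D$ and $D'$ (a bijection $f:D\to D'$ with $x f(x)\in E(G)$ for all $x\in D$). $DD_{\mathrm{m}}(G)$ is the minimum cardinality of a swap set of $G$, and $DD_{\mathrm{m}}(G)=\infty$ if none exists. *)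

theory Defs
  imports "Graph_Theory.Pair_Digraph" "HOL-Library.Extended_Nat"
begin

text \<open>
  Finite simple graphs are the instances of the locale \<^locale>\<open>pair_graph\<close>: an undirected edge
  \<open>uv\<close> is represented by the two arcs \<open>(u, v)\<close> and \<open>(v, u)\<close>. The definitions below are meant for
  such graphs, where all vertex sets involved are finite and \<^const>\<open>card\<close> is the true cardinality.
\<close>

definition path_graph :: "nat \<Rightarrow> nat pair_pre_digraph" where
  "path_graph k =
     \<lparr> pverts = {1..k},
       parcs = {(i, j). i \<in> {1..k} \<and> j \<in> {1..k} \<and> (j = i + 1 \<or> i = j + 1)} \<rparr>"

definition cartesian_product ::
  "'a pair_pre_digraph \<Rightarrow> 'b pair_pre_digraph \<Rightarrow> ('a \<times> 'b) pair_pre_digraph"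
  (infixr \<open>\<box>\<close> 80) where
  "G \<box> H =
     \<lparr> pverts = pverts G \<times> pverts H,
       parcs = {((a, b), (c, d)).
         (a \<in> pverts G \<and> a = c \<and> (b, d) \<in> parcs H) \<or>
         ((a, c) \<in> parcs G \<and> b \<in> pverts H \<and> b = d)} \<rparr>"

lemma pair_graph_path_graph: "pair_graph (path_graph k)"
proof
  show "finite (parcs (path_graph k))"
    by (rule finite_subset[of _ "{1..k} \<times> {1..k}"]) (auto simp: path_graph_def)
  show "symmetric (with_proj (path_graph k))"
    by (auto simp: symmetric_def sym_def path_graph_def)
qed (auto simp: path_graph_def)

lemma pair_graph_cartesian_product:
  assumes "pair_graph G" and "pair_graph H"
  shows "pair_graph (G \<box> H)"
proof -
  interpret G: pair_graph G by fact
  interpret H: pair_graph H by fact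
  have wf: "parcs (G \<box> H) \<subseteq> pverts (G \<box> H) \<times> pverts (G \<box> H)"
    by (auto simp: cartesian_product_def dest: G.wellformed' H.wellformed')
  have fin: "finite (pverts (G \<box> H))"
    by (simp add: cartesian_product_def)
  show ?thesis
  proof
    show "finite (parcs (G \<box> H))"
      using wf fin by (meson finite_SigmaI finite_subset)
    show "symmetric (with_proj (G \<box> H))"
      using G.sym_arcs H.sym_arcs
      by (auto simp: symmetric_def sym_def cartesian_product_def)
    show "fst e \<noteq> snd e" if "e \<in> parcs (G \<box> H)" for e
      using that G.no_loops H.no_loops by (fastforce simp: cartesian_product_def)
  qed (use wf fin in auto)
qed

definition dominating_set :: "'a pair_pre_digraph \<Rightarrow> 'a set \<Rightarrow> bool" where
  "dominating_set G D \<longleftrightarrow>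
     D \<subseteq> pverts G \<and> (\<forall>v \<in> pverts G - D. \<exists>u \<in> D. (u, v) \<in> parcs G)"

definition domination_number :: "'a pair_pre_digraph \<Rightarrow> nat" where
  "domination_number G = (LEAST k. \<exists>D. dominating_set G D \<and> card D = k)"

definition swap_set :: "'a pair_pre_digraph \<Rightarrow> 'a set \<Rightarrow> bool" where
  "swap_set G D \<longleftrightarrow>
     dominating_set G D \<and>
     (\<exists>D'. dominating_set G D' \<and> D \<inter> D' = {} \<and> card D = card D' \<and>
       (\<exists>f. bij_betw f D D' \<and> (\<forall>x \<in> D. (x, f x) \<in> parcs G)))"

text \<open>In \<^typ>\<open>enat\<close> the infimum of a nonempty set is its minimum, and that of the empty set is \<open>\<infinity>\<close>.\<close>

definition swap_number :: "'a pair_pre_digraph \<Rightarrow> enat" where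
  "swap_number G = Inf {enat (card D) | D. swap_set G D}"

end

theory Submission
  imports Defs
begin

text \<open>
  Scanning the \<open>3 \<times> n\<close> grid from left to right, a potential depending only on the last column and
  on which of its cells still lack a dominating neighbour shows that the first \<open>i\<close> columns meet a
  dominating set \<open>D\<close> in at least \<open>(3 * i + potential) / 4\<close> cells. For \<open>n = 4 * k + 1\<close> the possible
  final potentials give \<open>card D \<ge> 3 * k + 1\<close>, and even \<open>card D \<ge> 3 * k + 2\<close> if \<open>D\<close> misses the middle
  cell of the last column. Hence any two minimum dominating sets, of size \<open>3 * k + 1\<close>, intersect, so
  that none of them is a swap set. Conversely, the following period-4 pattern (here for \<open>n = 13\<close>)
  shows a swap set \<open>D\<close> of size \<open>3 * k + 2\<close> and its partner \<open>X\<close>.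

  \<^verbatim>\<open>
    . X D . . X D . . X D . D
    D X . X D . . X D . . X X
    . X D . . X D . . X D D .
  \<close>
\<close>

section \<open>Domination in the grid in coordinates\<close>

lemma grid_verts:
  "pverts (path_graph m \<box> path_graph n) = {1..m} \<times> {1..n}"
  by (simp add: cartesian_product_def path_graph_def)

lemma grid_arc_iff:
  "((r, i), (s, j)) \<in> parcs (path_graph m \<box> path_graph n) \<longleftrightarrow>
     r \<in> {1..m} \<and> s \<in> {1..m} \<and> i \<in> {1..n} \<and> j \<in> {1..n} \<and>
     (r = s \<and> (j = i + 1 \<or> i = j + 1) \<or> i = j \<and> (s = r + 1 \<or> r = s + 1))"
  by (auto simp: cartesian_product_def path_graph_def)

lemma atLeastAtMost_1_3: "{1..3::nat} = {1, 2, 3}"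
  by auto

text \<open>The boundary columns need no separate treatment: \<open>i - 1\<close> and
  \<open>i + 1\<close> may point to the columns \<open>0\<close> and \<open>n + 1\<close>, but these
  lie outside the grid and so contain no cell of \<open>D\<close>.\<close>

lemma dominating_set_grid3_iff:
  "dominating_set (path_graph 3 \<box> path_graph n) D \<longleftrightarrow>
     D \<subseteq> {1, 2, 3} \<times> {1..n} \<and>
     (\<forall>i \<in> {1..n}.
        ((1, i) \<in> D \<or> (2, i) \<in> D \<or> (1, i - 1) \<in> D \<or> (1, i + 1) \<in> D) \<and>
        ((2, i) \<in> D \<or> (1, i) \<in> D \<or> (3, i) \<in> D \<or> (2, i - 1) \<in> D \<or> (2, i + 1) \<in> D) \<and>
        ((3, i) \<in> D \<or> (2, i) \<in> D \<or> (3, i - 1) \<in> D \<or> (3, i + 1) \<in> D))"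
  (is "?L \<longleftrightarrow> ?S \<and> ?R")
proof
  assume L: ?L
  then have S: ?S
    unfolding dominating_set_def grid_verts atLeastAtMost_1_3 by blast
  have dom: "(r, i) \<in> D \<or> (\<exists>s j. (s, j) \<in> D \<and>
      ((s, j), (r, i)) \<in> parcs (path_graph 3 \<box> path_graph n))"
    if "r \<in> {1..3}" "i \<in> {1..n}" for r i
    using L that unfolding dominating_set_def grid_verts by fast
  have ?R
  proof (intro ballI conjI)
    fix i assume i: "i \<in> {1..n}"
    show "(1, i) \<in> D \<or> (2, i) \<in> D \<or> (1, i - 1) \<in> D \<or> (1, i + 1) \<in> D"
      using dom[of 1 i] i by (auto simp: grid_arc_iff numeral_2_eq_2)
    show "(2, i) \<in> D \<or> (1, i) \<in> D \<or> (3, i) \<in> D \<or> (2, i - 1) \<in> D \<or> (2, i + 1) \<in> D"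
      using dom[of 2 i] i by (auto simp: grid_arc_iff numeral_2_eq_2 numeral_3_eq_3)
    show "(3, i) \<in> D \<or> (2, i) \<in> D \<or> (3, i - 1) \<in> D \<or> (3, i + 1) \<in> D"
      using dom[of 3 i] i by (auto simp: grid_arc_iff numeral_2_eq_2 numeral_3_eq_3)
  qed
  with S show "?S \<and> ?R" ..
next
  assume R: "?S \<and> ?R"
  have "\<exists>x \<in> D. (x, v) \<in> parcs (path_graph 3 \<box> path_graph n)"
    if "v \<in> {1..3} \<times> {1..n} - D" for v
  proof -
    obtain r i where v: "v = (r, i)" by (cases v)
    have i: "i \<in> {1..n}" and r: "r = 1 \<or> r = 2 \<or> r = 3" and nD: "(r, i) \<notin> D"
      using that v by auto
    have nbr: "\<exists>x \<in> D. (x, (r, i)) \<in> parcs (path_graph 3 \<box> path_graph n)"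
      if "(s, j) \<in> D" "r = s \<and> (i = j + 1 \<or> j = i + 1) \<or> j = i \<and> (s = r + 1 \<or> r = s + 1)"
      for s j
      using that R i r by (intro bexI[of _ "(s, j)"]) (auto simp: grid_arc_iff)
    note dom = R[THEN conjunct2, rule_format, OF i]
    from r show ?thesis
      unfolding v
    proof (elim disjE)
      assume r: "r = 1"
      then have "(2, i) \<in> D \<or> (1, i - 1) \<in> D \<or> (1, i + 1) \<in> D"
        using dom nD by blast
      then show "\<exists>x \<in> D. (x, (r, i)) \<in> parcs (path_graph 3 \<box> path_graph n)"
        using nbr[of 2 i] nbr[of 1 "i - 1"] nbr[of 1 "i + 1"] r i by auto
    next
      assume r: "r = 2"
      then have "(1, i) \<in> D \<or> (3, i) \<in> D \<or> (2, i - 1) \<in> D \<or> (2, i + 1) \<in> D"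
        using dom nD by blast
      then show "\<exists>x \<in> D. (x, (r, i)) \<in> parcs (path_graph 3 \<box> path_graph n)"
        using nbr[of 1 i] nbr[of 3 i] nbr[of 2 "i - 1"] nbr[of 2 "i + 1"] r i by auto
    next
      assume r: "r = 3"
      then have "(2, i) \<in> D \<or> (3, i - 1) \<in> D \<or> (3, i + 1) \<in> D"
        using dom nD by blast
      then show "\<exists>x \<in> D. (x, (r, i)) \<in> parcs (path_graph 3 \<box> path_graph n)"
        using nbr[of 2 i] nbr[of 3 "i - 1"] nbr[of 3 "i + 1"] r i by auto
    qed
  qed
  then show ?L
    using R unfolding dominating_set_def grid_verts atLeastAtMost_1_3 by blast
qed

section \<open>Lower bounds from the column potential\<close>

text \<open>
  The arguments \<open>a b c\<close> describe a column, \<open>a' b' c'\<close> its left neighbour. The value is the minimum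
  of \<open>4 * cells - 3 * columns\<close> over all admissible beginnings of the grid that end in this column
  with the same cells of it still undominated.
\<close>

definition column_potential :: "bool \<Rightarrow> bool \<Rightarrow> bool \<Rightarrow> bool \<Rightarrow> bool \<Rightarrow> bool \<Rightarrow> int" where
  "column_potential a b c a' b' c' =
     (if b then (if a \<and> c then 6 else if a \<or> c then 4 else 1)
      else if a \<and> c then 3
      else if a then (if c' then 2 else 1)
      else if c then (if a' then 2 else 1)
      else if a' \<and> c' then (if b' then 3 else 0)
      else if a' \<or> c' then (if b' then 1 else -1)
      else (if b' then -2 else -3))"

text \<open>The premises say that the column \<open>a b c\<close> is dominated once
  \<open>x y z\<close> stands to its right. Appending \<open>x y z\<close> adds four times its
  number of cells, minus 3, to the minimised quantity, so the minimum grows by at most that. The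
  check is a finite case distinction.\<close>

lemma column_potential_step:
  assumes "a \<or> b \<or> a' \<or> x" "b \<or> a \<or> c \<or> b' \<or> y" "c \<or> b \<or> c' \<or> z"
  shows "column_potential x y z a b c + 3 \<le>
           column_potential a b c a' b' c' + 4 * (of_bool x + of_bool y + of_bool z)"
  using assms
  by (cases a; cases b; cases c; cases x; cases y; cases z; simp add: column_potential_def)

lemma column_potential_first:
  "column_potential x y z False False False + 3 \<le> 4 * (of_bool x + of_bool y + of_bool z)"
  by (cases x; cases y; cases z; simp add: column_potential_def)

text \<open>The last column must be dominated without a right neighbour. The value 1 needs the
  middle cell, which is what separates the two bounds on \<open>card D\<close>.\<close>

lemma column_potential_last:
  assumes "a \<or> b \<or> a'" "b \<or> a \<or> c \<or> b'" "c \<or> b \<or> c'"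
  shows "column_potential a b c a' b' c' \<ge> (if b then 1 else 2)"
  using assms by (auto simp: column_potential_def)

lemma card_grid3:
  fixes D :: "(nat \<times> nat) set"
  assumes "D \<subseteq> {1, 2, 3} \<times> {1..n}"
  shows "int (card D) =
    (\<Sum>i = 1..n. of_bool ((1, i) \<in> D) + of_bool ((2, i) \<in> D) + of_bool ((3, i) \<in> D))"
proof -
  have D: "({1, 2, 3} \<times> {1..n}) \<inter> D = D" using assms by blast
  have "int (card D) = (\<Sum>x \<in> {1, 2, 3} \<times> {1..n}. of_bool (x \<in> D))"
    by (subst sum_of_bool_eq) (simp_all only: Collect_mem_eq D finite_SigmaI finite_insert
        finite.emptyI finite_atLeastAtMost)
  also have "\<dots> = (\<Sum>r \<in> {1, 2, 3}. \<Sum>i = 1..n. of_bool ((r, i) \<in> D))"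
    by (simp only: sum.cartesian_product case_prod_unfold prod.collapse)
  finally show ?thesis by (simp add: sum.distrib)
qed

text \<open>Induction over the columns. The domination of column \<open>i\<close> is used only in
  the step to column \<open>i + 1\<close>, where its right neighbour is known.\<close>

lemma column_potential_le:
  assumes D: "dominating_set (path_graph 3 \<box> path_graph n) D" and i: "1 \<le> i" "i \<le> n"
  shows "3 * int i + column_potential ((1, i) \<in> D) ((2, i) \<in> D) ((3, i) \<in> D)
           ((1, i - 1) \<in> D) ((2, i - 1) \<in> D) ((3, i - 1) \<in> D)
         \<le> 4 * (\<Sum>j = 1..i. of_bool ((1, j) \<in> D) + of_bool ((2, j) \<in> D) + of_bool ((3, j) \<in> D))"
  using i
proof (induction i rule: nat_induct_at_least)
  case base
  \<comment> \<open>Column \<open>0\<close> acts as an empty left neighbour of the first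
    column.\<close>
  have "(r, 0) \<notin> D" for r using D by (auto simp: dominating_set_grid3_iff)
  then show ?case
    using column_potential_first[of "(1, 1) \<in> D" "(2, 1) \<in> D" "(3, 1) \<in> D"] by simp
next
  case (Suc i)
  then have "i \<in> {1..n}" by simp
  with D have dom: "(1, i) \<in> D \<or> (2, i) \<in> D \<or> (1, i - 1) \<in> D \<or> (1, Suc i) \<in> D"
    "(2, i) \<in> D \<or> (1, i) \<in> D \<or> (3, i) \<in> D \<or> (2, i - 1) \<in> D \<or> (2, Suc i) \<in> D"
    "(3, i) \<in> D \<or> (2, i) \<in> D \<or> (3, i - 1) \<in> D \<or> (3, Suc i) \<in> D"
    unfolding dominating_set_grid3_iff Suc_eq_plus1 by blast+
  show ?case
    using column_potential_step[OF dom] Suc.IH Suc.prems by simp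
qed

lemma dominating_set_grid3_card:
  assumes D: "dominating_set (path_graph 3 \<box> path_graph n) D" and n: "n = 4 * k + 1"
  shows "card D \<ge> 3 * k + 1" and "(2, n) \<notin> D \<Longrightarrow> card D \<ge> 3 * k + 2"
proof -
  have sub: "D \<subseteq> {1, 2, 3} \<times> {1..n}" using D by (simp add: dominating_set_grid3_iff)
  then have "(r, n + 1) \<notin> D" for r by auto
  moreover have "n \<in> {1..n}" using n by simp
  ultimately have
    "(1, n) \<in> D \<or> (2, n) \<in> D \<or> (1, n - 1) \<in> D"
    "(2, n) \<in> D \<or> (1, n) \<in> D \<or> (3, n) \<in> D \<or> (2, n - 1) \<in> D"
    "(3, n) \<in> D \<or> (2, n) \<in> D \<or> (3, n - 1) \<in> D"
    using D unfolding dominating_set_grid3_iff by blast+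
  from column_potential_last[OF this] column_potential_le[OF D, of n] n
  \<comment> \<open>For \<open>n = 4 * k + 1\<close> the right-hand side is
    \<open>12 * k + 4\<close> or \<open>12 * k + 5\<close>; dividing by 4 and rounding up gives the
    two bounds.\<close>
  have "4 * int (card D) \<ge> 3 * int n + (if (2, n) \<in> D then 1 else 2)"
    unfolding card_grid3[OF sub] by linarith
  then show "card D \<ge> 3 * k + 1" and "(2, n) \<notin> D \<Longrightarrow> card D \<ge> 3 * k + 2"
    using n by (auto split: if_splits)
qed

section \<open>A minimum dominating set of period 4\<close>

text \<open>Reduces a check of a period-4 pattern to four symbolic columns. Only residue 1 admits
  \<open>q = k\<close>, which is the last column.\<close>

lemma column_mod_4_cases:
  fixes i k :: nat
  assumes "i \<in> {1..4 * k + 1}"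
  obtains q where "i = 4 * q + 1" "q \<le> k" | q where "i = 4 * q + 2" "q < k"
    | q where "i = 4 * q + 3" "q < k" | q where "i = 4 * q + 4" "q < k"
proof -
  define q where "q = (i - 1) div 4"
  have "i = 4 * q + 1 \<and> q \<le> k \<or> i = 4 * q + 2 \<and> q < k \<or>
      i = 4 * q + 3 \<and> q < k \<or> i = 4 * q + 4 \<and> q < k"
    using assms div_mult_mod_eq[of "i - 1" 4] mod_less_divisor[of 4 "i - 1"]
    unfolding q_def atLeastAtMost_iff by arith
  then show thesis using that by blast
qed

lemma dominating_set_grid3_exists:
  assumes n: "n = 4 * k + 1"
  shows "\<exists>D. dominating_set (path_graph 3 \<box> path_graph n) D \<and> card D \<le> 3 * k + 1"
proof -
  \<comment> \<open>Middle cells in the columns of residue 1 alternate with pairs of outer cells in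
    those of residue 3, which makes \<open>k + 1\<close> plus \<open>2 * k\<close> cells.\<close>
  define D :: "(nat \<times> nat) set" where
    "D = (\<lambda>j. (2, 4 * j + 1)) ` {..k} \<union> (\<lambda>j. (1, 4 * j + 3)) ` {..<k}
         \<union> (\<lambda>j. (3, 4 * j + 3)) ` {..<k}"
  have mem: "(r, i) \<in> D \<longleftrightarrow> i \<le> n \<and>
      (r = 2 \<and> i mod 4 = 1 \<or> (r = 1 \<or> r = 3) \<and> i mod 4 = 3)" for r i
  proof -
    have i: "i mod 4 = 1 \<Longrightarrow> i = 4 * (i div 4) + 1" "i mod 4 = 3 \<Longrightarrow> i = 4 * (i div 4) + 3"
      using div_mult_mod_eq[of i 4] by linarith+
    moreover have "i \<le> n \<Longrightarrow> i mod 4 = 1 \<Longrightarrow> i div 4 \<le> k"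
      "i \<le> n \<Longrightarrow> i mod 4 = 3 \<Longrightarrow> i div 4 < k"
      using i n by linarith+
    ultimately show ?thesis
      unfolding D_def using n by (auto simp: image_iff)
  qed
  have "dominating_set (path_graph 3 \<box> path_graph n) D"
    unfolding dominating_set_grid3_iff
  proof (intro conjI ballI)
    show "D \<subseteq> {1, 2, 3} \<times> {1..n}"
      by (auto simp: mem intro: Suc_leI gr0I)
  qed (unfold n, (erule column_mod_4_cases; auto simp: mem n)+)
  moreover have "card D \<le> (k + 1) + k + k"
    unfolding D_def
    by (intro order_trans[OF card_Un_le] add_mono order_trans[OF card_image_le]) auto
  ultimately show ?thesis by auto
qed

lemma domination_number_grid3:
  assumes "n = 4 * k + 1"
  shows "domination_number (path_graph 3 \<box> path_graph n) = 3 * k + 1"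
proof -
  obtain D where D: "dominating_set (path_graph 3 \<box> path_graph n) D" "card D = 3 * k + 1"
    using dominating_set_grid3_exists[OF assms] dominating_set_grid3_card(1)[OF _ assms]
    by (meson le_antisym)
  show ?thesis
    unfolding domination_number_def
    by (rule Least_equality) (use D dominating_set_grid3_card(1)[OF _ assms] in auto)
qed

section \<open>Swap sets\<close>

text \<open>Of two disjoint sets, one misses \<open>(2, n)\<close> and obeys the stronger bound;
  equal cardinality carries it over to \<open>D\<close>.\<close>

lemma swap_set_grid3_card:
  assumes D: "swap_set (path_graph 3 \<box> path_graph n) D" and n: "n = 4 * k + 1"
  shows "card D \<ge> 3 * k + 2"
proof -
  obtain D' where "dominating_set (path_graph 3 \<box> path_graph n) D"
    "dominating_set (path_graph 3 \<box> path_graph n) D'" "D \<inter> D' = {}" "card D = card D'"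
    using D unfolding swap_set_def by blast
  then show ?thesis
    using dominating_set_grid3_card(2)[OF _ n] by (metis disjoint_iff)
qed

lemma swap_set_grid3_exists:
  assumes n: "n = 4 * k + 1" and k: "k > 0"
  shows "\<exists>D. swap_set (path_graph 3 \<box> path_graph n) D \<and> card D \<le> 3 * k + 2"
proof -
  \<comment> \<open>The minimum dominating set above, with its last cell \<open>(2, n)\<close>
    replaced by \<open>(3, n - 1)\<close> and \<open>(1, n)\<close>. This frees
    \<open>(2, n)\<close> for the partner \<open>X\<close>.\<close>
  define D :: "(nat \<times> nat) set" where
    "D = (\<lambda>j. (2, 4 * j + 1)) ` {..<k} \<union> (\<lambda>j. (1, 4 * j + 3)) ` {..<k}
         \<union> (\<lambda>j. (3, 4 * j + 3)) ` {..<k} \<union> {(3, n - 1), (1, n)}"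
  define X :: "(nat \<times> nat) set" where
    "X = {(r, i). 0 < i \<and> i \<le> n \<and>
       ((r = 1 \<or> r = 3) \<and> i mod 4 = 2 \<or> r = 2 \<and> (i = 2 \<or> i = n \<or> i mod 4 = 0))}"
  \<comment> \<open>Each cell is matched with its left neighbour, except that \<open>(2, 1)\<close>
    goes right and the two replacement cells go vertically to the middle row. The map
    \<open>g\<close> reverses this.\<close>
  define f :: "nat \<times> nat \<Rightarrow> nat \<times> nat" where
    "f = (\<lambda>(r, i). if n - 1 \<le> i then (2, i) else if i = 1 then (2, 2) else (r, i - 1))"
  define g :: "nat \<times> nat \<Rightarrow> nat \<times> nat" where
    "g = (\<lambda>(r, i). if i = n then (1, n) else if i = n - 1 then (3, n - 1)
                   else if (r, i) = (2, 2) then (2, 1) else (r, i + 1))"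
  have memD: "(r, i) \<in> D \<longleftrightarrow> i < n \<and>
      (r = 2 \<and> i mod 4 = 1 \<or> (r = 1 \<or> r = 3) \<and> i mod 4 = 3) \<or>
      (r = 3 \<and> i = n - 1) \<or> (r = 1 \<and> i = n)" for r i
  proof -
    have i: "i mod 4 = 1 \<Longrightarrow> i = 4 * (i div 4) + 1" "i mod 4 = 3 \<Longrightarrow> i = 4 * (i div 4) + 3"
      using div_mult_mod_eq[of i 4] by linarith+
    moreover have "i < n \<Longrightarrow> i mod 4 = 1 \<Longrightarrow> i div 4 < k" "i < n \<Longrightarrow> i mod 4 = 3 \<Longrightarrow> i div 4 < k"
      using i n by linarith+
    ultimately show ?thesis
      unfolding D_def using n by (auto simp: image_iff)
  qed
  have memX: "(r, i) \<in> X \<longleftrightarrow> 0 < i \<and> i \<le> n \<and>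
       ((r = 1 \<or> r = 3) \<and> i mod 4 = 2 \<or> r = 2 \<and> (i = 2 \<or> i = n \<or> i mod 4 = 0))" for r i
    by (simp add: X_def)
  have domD: "dominating_set (path_graph 3 \<box> path_graph n) D"
    unfolding dominating_set_grid3_iff
  proof (intro conjI ballI)
    show "D \<subseteq> {1, 2, 3} \<times> {1..n}"
      using n k by (auto simp: memD intro: Suc_leI gr0I)
  qed (unfold n, (erule column_mod_4_cases; use k in \<open>auto simp: memD n\<close>)+)
  \<comment> \<open>Residue facts for the columns \<open>4 * q + 2\<close> and
    \<open>4 * q + 1\<close> in \<open>Suc\<close> form, for deciding membership in
    \<open>X\<close>.\<close>
  have [simp]: "Suc (Suc (4 * q)) mod 4 = 2" "Suc (4 * q) \<noteq> 4 * j" for q j :: nat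
    by presburger+
  have domX: "dominating_set (path_graph 3 \<box> path_graph n) X"
    unfolding dominating_set_grid3_iff
  proof (intro conjI ballI)
    show "X \<subseteq> {1, 2, 3} \<times> {1..n}"
      using n k by (auto simp: memX)
  qed (unfold n, (erule column_mod_4_cases; use k in \<open>auto simp: memX n\<close>)+)
  have disj: "D \<inter> X = {}"
    using n k by (auto simp: memD memX)
  have fX: "f x \<in> X \<and> g (f x) = x \<and> (x, f x) \<in> parcs (path_graph 3 \<box> path_graph n)"
    if "x \<in> D" for x
  proof -
    obtain r i where x: "x = (r, i)" by (cases x)
    have "i \<in> {1..4 * k + 1}" using that domD n by (auto simp: x dominating_set_grid3_iff)
    then show ?thesis
      by (cases rule: column_mod_4_cases;
          use that k in \<open>auto simp: x n f_def g_def memD memX grid_arc_iff\<close>)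
  qed
  have gD: "g x \<in> D \<and> f (g x) = x" if "x \<in> X" for x
  proof -
    obtain r i where x: "x = (r, i)" by (cases x)
    have "i \<in> {1..4 * k + 1}" using that domX n by (auto simp: x dominating_set_grid3_iff)
    then show ?thesis
      by (cases rule: column_mod_4_cases;
          use that k in \<open>auto simp: x n f_def g_def memD memX\<close>; presburger)
  qed
  have bij: "bij_betw f D X"
    by (rule bij_betw_byWitness[where f' = g]) (use fX gD in auto)
  have "swap_set (path_graph 3 \<box> path_graph n) D"
    unfolding swap_set_def using domD domX disj bij_betw_same_card[OF bij] bij fX by blast
  moreover have "card {(3, n - 1), (1, n)} \<le> (2::nat)"
    by (simp add: card_insert_if)
  then have "card D \<le> k + k + k + 2"
    unfolding D_def
    by (intro order_trans[OF card_Un_le] add_mono order_trans[OF card_image_le]) auto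
  ultimately show ?thesis by auto
qed

theorem lemma30:
  fixes n :: nat
  assumes "n > 9" and "n mod 4 = 1"
  shows "swap_number (path_graph 3 \<box> path_graph n) =
         enat (domination_number (path_graph 3 \<box> path_graph n) + 1)"
proof -
  obtain k where n: "n = 4 * k + 1"
    using assms(2) by (metis mult_div_mod_eq)
  then have k: "k > 0" using assms(1) by simp
  obtain D where D: "swap_set (path_graph 3 \<box> path_graph n) D" "card D \<le> 3 * k + 2"
    using swap_set_grid3_exists[OF n k] by blast
  have "swap_number (path_graph 3 \<box> path_graph n) = enat (3 * k + 2)"
    unfolding swap_number_def
  proof (rule antisym)
    show "Inf {enat (card D) |D. swap_set (path_graph 3 \<box> path_graph n) D} \<le> enat (3 * k + 2)"
      by (rule Inf_lower2[of "enat (card D)"]) (use D in auto)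
    show "enat (3 * k + 2) \<le> Inf {enat (card D) |D. swap_set (path_graph 3 \<box> path_graph n) D}"
      by (rule Inf_greatest) (use swap_set_grid3_card[OF _ n] in auto)
  qed
  then show ?thesis by (simp add: domination_number_grid3[OF n])
qed

end
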